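(* Let $n\ge3$ be an odd integer. A strong cardioidal starter of order $n$ exists if and only if $n\in\overline{C_2\setminus\{3\}}$, i.e. $n$ is a product of one or more (not necessarily distinct) primes from $C_2$ none of which equals $3$.
   Context: $C_2$ is the set of (odd) primes $p$ such that the multiplicative order of $2$ modulo $p$ is $\equiv2\pmod4$; for a set of primes $Y$, $\overline{Y}$ is the set of all products of one or more (not necessarily distinct) primes from $Y$. A starter of order $n$ ($n$ odd) is a partition of $\mathbb{Z}_n\setminus\{0\}$ into $(n-1)/2$ pairs $\{s_i,t_i\}$ such that the elements $\pm(s_i-t_i)$ are exactly the non-zero elements of $\mathbb{Z}_n$; it is strong if the sums $s_i+t_i$ are non-zero and pairwise distinct. A starter is cardioidal if every pair has the form $\{i,2i\bmod n\}$ for some $i\in\mathbb{Z}_n\setminus\{0\}$. *)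

theory Defs
  imports "HOL-Number_Theory.Number_Theory" "HOL-Library.Disjoint_Sets" "HOL-Library.Multiset"
begin

definition C2 :: "nat set" where
  "C2 = {p. prime p \<and> odd p \<and> [ord p 2 = 2] (mod 4)}"

definition prime_products :: "nat set \<Rightarrow> nat set" where
  "prime_products Y = {prod_mset M | M. M \<noteq> {#} \<and> set_mset M \<subseteq> Y}"

text \<open>The group of integers modulo \<open>n\<close> is represented by the least non-negative residues,
  with the operations of \<^typ>\<open>int\<close> reduced modulo \<open>n\<close>.\<close>

definition nonzero_residues :: "nat \<Rightarrow> int set" where
  "nonzero_residues n = {0..<int n} - {0}"

text \<open>A starter is a set of two-element sets. In the set of differences both \<open>s - t\<close> and \<open>t - s\<close>
  occur for each pair, since \<open>{s, t} = {t, s}\<close>.\<close>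

definition starter :: "nat \<Rightarrow> int set set \<Rightarrow> bool" where
  "starter n S \<longleftrightarrow>
     odd n \<and>
     partition_on (nonzero_residues n) S \<and>
     (\<forall>P\<in>S. card P = 2) \<and>
     card S = (n - 1) div 2 \<and>
     {(s - t) mod int n | s t. {s, t} \<in> S} = nonzero_residues n"

definition strong_starter :: "nat \<Rightarrow> int set set \<Rightarrow> bool" where
  "strong_starter n S \<longleftrightarrow>
     starter n S \<and>
     (\<forall>P\<in>S. (\<Sum>x\<in>P. x) mod int n \<noteq> 0) \<and>
     inj_on (\<lambda>P. (\<Sum>x\<in>P. x) mod int n) S"

definition cardioidal_starter :: "nat \<Rightarrow> int set set \<Rightarrow> bool" where
  "cardioidal_starter n S \<longleftrightarrow>
     starter n S \<and>
     (\<forall>P\<in>S. \<exists>i\<in>nonzero_residues n. P = {i, (2 * i) mod int n})"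

end

theory Submission
  imports Defs
begin

text \<open>Suppose that \<open>S\<close> is a strong cardioidal starter and let \<open>H\<close> be the set of all \<open>x\<close>
  with \<open>{x, 2x}\<close> in \<open>S\<close>. The differences of the pairs are the elements of \<open>H\<close> and \<open>-H\<close>, so
  \<open>H\<close> and \<open>-H\<close> partition the nonzero residues; the pairs themselves partition them into \<open>H\<close> and
  \<open>2H\<close>. Hence \<open>2H = -H\<close>, i.e. \<open>H\<close> is closed under multiplication by \<open>-2\<close>. Such an \<open>H\<close>
  exists iff no \<open>-x\<close> with \<open>x \<noteq> 0\<close> lies in the orbit of \<open>x\<close> under multiplication by \<open>-2\<close>, i.e.
  iff \<open>-1\<close> is not a power of \<open>-2\<close> modulo any prime divisor of \<open>n\<close>, and for an odd prime this means
  that the order of \<open>2\<close> is \<open>2\<close> modulo \<open>4\<close>. The pair sums are the elements of \<open>3H\<close>, so strength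
  amounts to \<open>n\<close> not being divisible by \<open>3\<close>.\<close>

section \<open>Powers of -2 modulo an odd prime\<close>

text \<open>If the order of 2 is 2k, then 2^k is -1 modulo \<open>p\<close>. For odd k this makes
  (-2)^k equal to 1, so every power of -2 has k-th power 1, while -1 does not. For even k, (-2)^k is
  itself -1; for an odd order m, (-2)^m is -1.\<close>

lemma mem_C2_iff:
  assumes "prime p" "odd p"
  shows "p \<in> C2 \<longleftrightarrow> (\<forall>j. \<not> int p dvd (-2) ^ j + 1)"
proof -
  let ?m = "ord p 2"
  have copr: "coprime p 2"
    using assms by simp
  then have pos: "0 < ?m"
    using ord_eq_0 [of p 2] by (intro gr0I) simp
  have pow_iff: "int p dvd 2 ^ d - 1 \<longleftrightarrow> ?m dvd d" for d
    using ord_divides [of 2 d p] cong_int_iff [of "2 ^ d" 1 p]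
    by (simp add: cong_iff_dvd_diff)
  have p2: "\<not> int p dvd 2"
  proof
    assume "int p dvd 2"
    then have "p dvd 2"
      using int_dvd_int_iff [of p 2] by simp
    then have "p = 2"
      by (intro primes_dvd_imp_eq [OF \<open>prime p\<close>]) simp_all
    then show False
      using \<open>odd p\<close> by simp
  qed
  \<comment> \<open>\<open>2 ^ k\<close> is a square root of 1 modulo \<open>p\<close>, and it
    differs from 1 because k lies strictly below the order.\<close>
  have half: "int p dvd 2 ^ k + 1" if k: "?m = 2 * k" for k
  proof -
    have "(2::int) ^ (2 * k) - 1 = (2 ^ k - 1) * (2 ^ k + 1)"
      unfolding mult_2 power_add by (simp add: algebra_simps)
    moreover have "int p dvd 2 ^ (2 * k) - 1"
      using pow_iff k by simp
    moreover have "\<not> int p dvd 2 ^ k - 1"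
      using pow_iff k pos by (auto dest: dvd_imp_le)
    ultimately show ?thesis
      using \<open>prime p\<close> by (simp only: prime_dvd_mult_iff prime_nat_int_transfer) blast
  qed
  show ?thesis
  proof
    assume "p \<in> C2"
    then have "?m mod 4 = 2"
      by (simp add: C2_def cong_def)
    then have "even ?m" and m4: "\<not> 4 dvd ?m"
      by presburger+
    then obtain k where "?m = 2 * k"
      by blast
    with m4 have k: "?m = 2 * k" "odd k"
      by (auto elim!: evenE)
    have "int p dvd - (2 ^ k + 1)"
      using half [OF k(1)] by (simp only: dvd_minus_iff)
    moreover have "- (2 ^ k + 1) = (-2 :: int) ^ k - 1"
      using k(2) by simp
    ultimately have "[(-2) ^ k = 1] (mod int p)"
      by (simp only: cong_iff_dvd_diff)
    then have one: "[((-2) ^ k) ^ j = 1] (mod int p)" for j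
      using cong_pow by fastforce
    show "\<forall>j. \<not> int p dvd (-2) ^ j + 1"
    proof (intro allI notI)
      fix j
      assume "int p dvd (-2) ^ j + 1"
      then have "[(-2) ^ j = -1] (mod int p)"
        by (simp add: cong_iff_dvd_diff)
      then have "[((-2) ^ j) ^ k = (-1) ^ k] (mod int p)"
        by (rule cong_pow)
      moreover have "((-2 :: int) ^ j) ^ k = ((-2) ^ k) ^ j"
        by (simp only: power_mult [symmetric] mult.commute)
      moreover have "(-1 :: int) ^ k = -1"
        using k(2) by simp
      ultimately have "[((-2) ^ k) ^ j = -1] (mod int p)"
        by (simp only:)
      then have "[-1 = 1] (mod int p)"
        using one [of j] by (blast intro: cong_trans cong_sym)
      then show False
        using p2 by (simp add: cong_iff_dvd_diff)
    qed
  next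
    assume R: "\<forall>j. \<not> int p dvd (-2) ^ j + 1"
    have "even ?m"
    proof (rule ccontr)
      assume "odd ?m"
      then have "(-2 :: int) ^ ?m + 1 = - (2 ^ ?m - 1)"
        by simp
      then have "int p dvd (-2) ^ ?m + 1"
        using pow_iff [of ?m] by (simp only: dvd_minus_iff dvd_refl)
      with R show False by blast
    qed
    then obtain k where k: "?m = 2 * k" ..
    have "odd k"
    proof
      assume "even k"
      then have "int p dvd (-2) ^ k + 1"
        using half [OF k] by simp
      with R show False by blast
    qed
    then have "?m mod 4 = 2"
      unfolding k by presburger
    then show "p \<in> C2"
      using assms by (simp add: C2_def cong_def)
  qed
qed

text \<open>A prime dividing a product of primes is one of the factors. Conversely the prime
  factorization is the required multiset, nonempty because \<open>n > 1\<close>.\<close>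

lemma mem_prime_products_iff:
  assumes "n > 1" and prime_Y: "\<And>p. p \<in> Y \<Longrightarrow> prime p"
  shows "n \<in> prime_products Y \<longleftrightarrow> (\<forall>p. prime p \<and> p dvd n \<longrightarrow> p \<in> Y)"
proof
  assume "n \<in> prime_products Y"
  then obtain M where M: "n = prod_mset M" "set_mset M \<subseteq> Y"
    by (auto simp: prime_products_def)
  show "\<forall>p. prime p \<and> p dvd n \<longrightarrow> p \<in> Y"
  proof (intro allI impI; elim conjE)
    fix p assume "prime p" "p dvd n"
    then obtain q where "q \<in># M" "p dvd q"
      using M by (metis prime_dvd_prod_mset_iff)
    then show "p \<in> Y"
      using M prime_Y \<open>prime p\<close> by (metis primes_dvd_imp_eq subsetD)
  qed
next
  assume "\<forall>p. prime p \<and> p dvd n \<longrightarrow> p \<in> Y"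
  then show "n \<in> prime_products Y"
    using assms unfolding prime_products_def
    by (intro CollectI exI [of _ "prime_factorization n"])
      (auto simp: prod_mset_prime_factorization_nat prime_factorization_empty_iff dest: in_prime_factors_imp_prime in_prime_factors_imp_dvd)
qed

section \<open>Half systems closed under -2, and the prime divisors of n\<close>

text \<open>As in Gauss's lemma, one residue is chosen from each pair of opposite nonzero residues.
  A congruence-invariant predicate on all integers avoids reducing every product. Its value on
  multiples of \<open>n\<close> is left free, since there \<open>x\<close> and \<open>- x\<close>
  are congruent.\<close>

definition half_system :: "nat \<Rightarrow> (int \<Rightarrow> bool) \<Rightarrow> bool" where
  "half_system n H \<longleftrightarrow>
     (\<forall>x y. [x = y] (mod int n) \<longrightarrow> H x = H y) \<and>
     (\<forall>x. H x \<longrightarrow> H (-2 * x)) \<and>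
     (\<forall>x. \<not> int n dvd x \<longrightarrow> H (- x) = (\<not> H x))"

text \<open>The test element is q = n / p, which is nonzero modulo \<open>n\<close>. If
  \<open>p\<close> divided (-2)^j + 1, multiplication by (-2)^j would exchange q and -q modulo
  \<open>n\<close>, so \<open>H\<close> would hold at both or at neither.\<close>

lemma half_system_imp_not_dvd:
  assumes H: "half_system n H" and "prime p" "p dvd n" "n > 0"
  shows "\<not> int p dvd (-2) ^ j + 1"
proof
  assume dvd: "int p dvd (-2) ^ j + 1"
  obtain q where q: "n = p * q"
    using \<open>p dvd n\<close> ..
  have "\<not> int n dvd int q"
    using q assms by (auto dest!: dvd_imp_le simp: prime_gt_1_nat)
  then have flip: "H (- int q) = (\<not> H (int q))"
    using H by (simp add: half_system_def)
  have pow: "H x \<Longrightarrow> H ((-2) ^ i * x)" for x i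
    using H by (induction i) (auto simp: half_system_def mult.assoc)
  have "int n dvd ((-2) ^ j + 1) * int q"
    using dvd q by (simp add: mult_dvd_mono)
  then have "[(-2) ^ j * int q = - int q] (mod int n)"
            "[(-2) ^ j * (- int q) = int q] (mod int n)"
    by (simp_all add: cong_iff_dvd_diff algebra_simps dvd_minus_iff [of _ "int q + _"])
      (metis add.inverse_inverse dvd_minus_iff minus_add_distrib uminus_add_conv_diff add.commute)
  then have "H (int q) \<Longrightarrow> H (- int q)" "H (- int q) \<Longrightarrow> H (int q)"
    using pow H unfolding half_system_def by metis+
  with flip show False by blast
qed

text \<open>For nonzero \<open>x\<close> the orbits of \<open>x\<close> and \<open>- x\<close> under
  multiplication by -2 are disjoint, so from each two opposite orbits one can choose the orbit with
  the smaller least residue.\<close>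

lemma half_system_exists:
  assumes "odd n" and no: "\<And>p j. prime p \<Longrightarrow> p dvd n \<Longrightarrow> \<not> int p dvd (-2) ^ j + 1"
  shows "\<exists>H. half_system n H"
proof -
  define orb where "orb x = range (\<lambda>j. ((-2) ^ j * x) mod int n)" for x :: int
  have n0: "n > 0" using \<open>odd n\<close> by (simp add: odd_pos)
  have fin: "finite (orb x)" for x
    by (rule finite_subset [of _ "{0..<int n}"]) (use n0 in \<open>auto simp: orb_def\<close>)
  have orb_closed: "orb y \<subseteq> orb x" if "[(-2) ^ i * x = y] (mod int n)" for x y i
  proof
    fix z assume "z \<in> orb y"
    then obtain j where "z = ((-2) ^ j * y) mod int n"
      by (auto simp: orb_def)
    also have "\<dots> = ((-2) ^ (j + i) * x) mod int n"
      using cong_mult [OF cong_refl that, of "(-2) ^ j"] by (simp add: cong_def power_add mult.assoc)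
    finally show "z \<in> orb x" by (auto simp: orb_def)
  qed
  have orb_sym: "\<exists>k. [(-2) ^ k * y = x] (mod int n)" if "[(-2) ^ i * x = y] (mod int n)" for x y i
  proof -
    \<comment> \<open>Doubling the totient makes the exponent even, so that Euler's theorem for 2
      carries over to -2.\<close>
    define t where "t = totient n * 2"
    have t: "t > 0" using n0 by (simp add: t_def)
    have "[2 ^ totient n = 1] (mod int n)"
      using euler_theorem [of 2 n] \<open>odd n\<close> cong_int_iff [of "2 ^ totient n" 1 n] by simp
    then have "[(2 ^ totient n) ^ 2 = 1 ^ 2] (mod int n)"
      by (rule cong_pow)
    then have "[(-2) ^ t = 1] (mod int n)"
      by (simp add: t_def flip: power_mult)
    then have "[((-2) ^ t) ^ i = 1] (mod int n)"
      using cong_pow by fastforce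
    then have one: "[(-2) ^ (t * i) * x = x] (mod int n)"
      using cong_mult [OF _ cong_refl] by (fastforce simp: power_mult)
    \<comment> \<open>Thus \<open>(-2) ^ ((t - 1) * i)\<close> inverts \<open>(-2) ^ i\<close>
      modulo \<open>n\<close>.\<close>
    have "t * i = (t - 1) * i + i" using t by (cases t) auto
    then have "(-2) ^ ((t - 1) * i) * ((-2) ^ i * x) = (-2) ^ (t * i) * x"
      by (simp add: power_add mult.assoc)
    with one have "[(-2) ^ ((t - 1) * i) * y = x] (mod int n)"
      using cong_mult [OF cong_refl that, of "(-2) ^ ((t - 1) * i)"] by (metis cong_sym cong_trans)
    then show ?thesis ..
  qed
  have orb_eq: "orb y = orb x" if "[(-2) ^ i * x = y] (mod int n)" for x y i
    using orb_closed orb_sym that by (metis subset_antisym)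
  \<comment> \<open>Equal minima are a common element of both orbits; inverting a power of -2 then
    leads from \<open>- x\<close> back to \<open>x\<close>.\<close>
  have neg: "Min (orb x) \<noteq> Min (orb (- x))" if x: "\<not> int n dvd x" for x
  proof
    assume "Min (orb x) = Min (orb (- x))"
    moreover have "Min (orb y) \<in> orb y" for y
      using fin by (intro Min_in) (auto simp: orb_def)
    ultimately have "Min (orb x) \<in> orb x" "Min (orb x) \<in> orb (- x)"
      by metis+
    then obtain i j where "[(-2) ^ i * x = Min (orb x)] (mod int n)"
        "[(-2) ^ j * (- x) = Min (orb x)] (mod int n)"
      unfolding orb_def cong_def by (metis (no_types, lifting) mod_mod_trivial rangeE)
    then have "[(-2) ^ j * (- x) = (-2) ^ i * x] (mod int n)"
      using cong_sym cong_trans by blast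
    moreover obtain k where "[(-2) ^ k * ((-2) ^ i * x) = x] (mod int n)"
      using orb_sym cong_refl by blast
    ultimately have "[(-2) ^ k * ((-2) ^ j * (- x)) = x] (mod int n)"
      using cong_mult [OF cong_refl, of _ _ "int n" "(-2) ^ k"] cong_trans by blast
    then have "int n dvd ((-2) ^ (k + j) + 1) * x"
      by (simp add: cong_iff_dvd_diff power_add algebra_simps) (metis dvd_minus_iff minus_add_distrib uminus_add_conv_diff add.commute)
    \<comment> \<open>If the two were coprime, \<open>n\<close> would divide \<open>x\<close>. A
      common prime factor contradicts the hypothesis.\<close>
    then have "\<not> coprime (int n) ((-2) ^ (k + j) + 1)"
      using x coprime_dvd_mult_right_iff by blast
    then have "\<not> is_unit (gcd (int n) ((-2) ^ (k + j) + 1))"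
      by (simp add: coprime_iff_gcd_eq_1)
    moreover have "gcd (int n) ((-2) ^ (k + j) + 1) \<noteq> 0"
      using n0 by simp
    ultimately obtain q where "prime q" "q dvd gcd (int n) ((-2) ^ (k + j) + 1)"
      using prime_divisor_exists by blast
    then have q: "q dvd int n" "q dvd (-2) ^ (k + j) + 1"
      by simp_all
    obtain p where p: "q = int p"
      using prime_ge_0_int [OF \<open>prime q\<close>] nonneg_int_cases by blast
    then have "prime p" "p dvd n"
      using \<open>prime q\<close> q by simp_all
    then show False
      using no [of p "k + j"] q p by blast
  qed
  \<comment> \<open>At multiples of \<open>n\<close> both orbits are {0}, and the strict comparison
    makes the predicate false.\<close>
  have "half_system n (\<lambda>x. Min (orb x) < Min (orb (- x)))"
    unfolding half_system_def
  proof (intro conjI allI impI)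
    fix x y assume "[x = y] (mod int n)"
    then have "orb y = orb x" "orb (- y) = orb (- x)"
      using orb_eq [of 0 x y] orb_eq [of 0 "- x" "- y"] by (simp_all add: cong_minus_minus_iff)
    then show "(Min (orb x) < Min (orb (- x))) = (Min (orb y) < Min (orb (- y)))"
      by simp
  next
    fix x assume "Min (orb x) < Min (orb (- x))"
    moreover have "orb (- 2 * x) = orb x" "orb (- (- 2 * x)) = orb (- x)"
      using orb_eq [of 1 x "- 2 * x"] orb_eq [of 1 "- x" "- (- 2 * x)"] by simp_all
    ultimately show "Min (orb (- 2 * x)) < Min (orb (- (- 2 * x)))"
      by simp
  qed (use neg in force)
  then show ?thesis by blast
qed

section \<open>Arithmetic of the pairs {x, 2x}\<close>

abbreviation doubling_pair :: "nat \<Rightarrow> int \<Rightarrow> int set" where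
  "doubling_pair n x \<equiv> {x mod int n, (2 * x) mod int n}"

lemma nonzero_residues_iff:
  "n > 0 \<Longrightarrow> x \<in> nonzero_residues n \<longleftrightarrow> x mod int n = x \<and> \<not> int n dvd x"
  by (auto simp: nonzero_residues_def dvd_eq_mod_eq_0 mod_pos_pos_trivial)
    (metis mod_pos_pos_trivial pos_mod_sign pos_mod_bound of_nat_0_less_iff)+

lemma mod_in_nonzero_residues:
  "n > 0 \<Longrightarrow> x mod int n \<in> nonzero_residues n \<longleftrightarrow> \<not> int n dvd x"
  by (simp add: nonzero_residues_iff mod_mod_trivial dvd_mod_iff)

lemma card_nonzero_residues: "card (nonzero_residues n) = n - 1"
  by (cases n) (auto simp: nonzero_residues_def)

lemma odd_dvd_double_iff: "odd n \<Longrightarrow> int n dvd 2 * x \<longleftrightarrow> int n dvd x"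
  by (simp add: coprime_dvd_mult_right_iff)

lemma dvd_three_mult_iff: "\<not> 3 dvd n \<Longrightarrow> int n dvd 3 * x \<longleftrightarrow> int n dvd x"
proof -
  assume "\<not> 3 dvd n"
  then have "coprime (3::nat) n"
    by (intro prime_imp_coprime) auto
  then have "coprime (int n) 3"
    by (metis coprime_commute coprime_int_iff of_nat_numeral)
  then show ?thesis
    by (simp add: coprime_dvd_mult_right_iff)
qed

text \<open>Two such sets might also agree crosswise, with x = 2y and y = 2x modulo
  \<open>n\<close>. This forces 3x = 0, which is impossible because 3 is invertible modulo
  \<open>n\<close>.\<close>

lemma doubling_pair_eq_iff:
  assumes "odd n" "\<not> 3 dvd n" "\<not> int n dvd x"
  shows "doubling_pair n x = doubling_pair n y \<longleftrightarrow> [x = y] (mod int n)"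
proof
  assume eq: "doubling_pair n x = doubling_pair n y"
  show "[x = y] (mod int n)"
  proof (rule ccontr)
    assume "\<not> [x = y] (mod int n)"
    with eq have "[x = 2 * y] (mod int n)" "[2 * x = y] (mod int n)"
      by (auto simp: cong_def doubleton_eq_iff)
    then have "int n dvd 2 * (2 * x - y) - (x - 2 * y)"
      by (metis cong_iff_dvd_diff dvd_diff dvd_mult)
    then have "int n dvd 3 * x"
      by (simp add: algebra_simps)
    with assms dvd_three_mult_iff show False by blast
  qed
next
  assume "[x = y] (mod int n)"
  then show "doubling_pair n x = doubling_pair n y"
    using cong_mult [OF cong_refl, of x y "int n" 2] by (simp add: cong_def)
qed

lemma doubling_not_cong:
  assumes "\<not> int n dvd x"
  shows "\<not> [2 * x = x] (mod int n)" "\<not> [x = 2 * x] (mod int n)"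
  using assms by (simp_all add: cong_iff_dvd_diff)

text \<open>As \<open>x\<close> is nonzero, the two entries differ and the sum over the set counts
  both.\<close>

lemma sum_doubling_pair:
  assumes "\<not> int n dvd x"
  shows "(\<Sum>y\<in>doubling_pair n x. y) mod int n = (3 * x) mod int n"
proof -
  have "(\<Sum>y\<in>doubling_pair n x. y) = x mod int n + (2 * x) mod int n"
    using doubling_not_cong [OF assms] by (simp add: cong_def)
  then show ?thesis
    by (simp add: mod_add_eq)
qed

section \<open>From strong cardioidal starters to half systems\<close>

text \<open>If n = 3i, the pair containing i is {k, 2k} with k = i or 2k = i modulo
  \<open>n\<close>. Either way 3k = 0, a pair sum that strength forbids.\<close>

lemma strong_cardioidal_imp_not_3_dvd:
  assumes S: "strong_starter n S" "cardioidal_starter n S" and "n > 0"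
  shows "\<not> 3 dvd n"
proof
  assume "3 dvd n"
  then obtain i where i: "n = 3 * i" ..
  have "odd n"
    using S by (simp add: cardioidal_starter_def starter_def)
  have "int i \<in> nonzero_residues n"
    using i \<open>n > 0\<close> by (auto simp: nonzero_residues_def)
  then obtain P where "P \<in> S" "int i \<in> P"
    using S unfolding cardioidal_starter_def starter_def partition_on_def by blast
  then obtain k where k: "k \<in> nonzero_residues n" "P = {k, (2 * k) mod int n}"
    using S unfolding cardioidal_starter_def by blast
  then have k': "k mod int n = k" "\<not> int n dvd k"
    using nonzero_residues_iff [OF \<open>n > 0\<close>] by blast+
  have "int n dvd 3 * k"
  proof -
    from \<open>int i \<in> P\<close> k consider "int i = k" | "int i = (2 * k) mod int n" by blast
    then show ?thesis
    proof cases
      case 1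
      then show ?thesis using i by simp
    next
      case 2
      then have "[3 * (2 * k) = 3 * int i] (mod int n)"
        by (intro cong_mult) (auto simp: cong_def)
      moreover have "int n dvd 3 * int i"
        using i by simp
      ultimately have "int n dvd 2 * (3 * k)"
        using cong_dvd_iff [of "3 * (2 * k)" "3 * int i" "int n"] by (simp add: mult.left_commute)
      then show ?thesis
        using odd_dvd_double_iff [OF \<open>odd n\<close>] by blast
    qed
  qed
  moreover have "P = doubling_pair n k"
    using k k' by simp
  ultimately show False
    using S(1) \<open>P \<in> S\<close> sum_doubling_pair [OF k'(2)] by (auto simp: strong_starter_def)
qed

text \<open>Disjointness of the pairs excludes \<open>2 * x\<close> as a generator whenever
  \<open>x\<close> is one, the differences make at least one of any two opposite residues a
  generator, and counting excludes both.\<close>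

lemma strong_cardioidal_imp_half_system:
  assumes S: "strong_starter n S" "cardioidal_starter n S" and "n > 0"
  shows "half_system n (\<lambda>x. doubling_pair n x \<in> S)"
proof -
  have n3: "\<not> 3 dvd n"
    using strong_cardioidal_imp_not_3_dvd assms by blast
  have "odd n" and part: "partition_on (nonzero_residues n) S" and card_S: "card S = (n - 1) div 2"
    and diffs: "{(s - t) mod int n | s t. {s, t} \<in> S} = nonzero_residues n"
    using S by (simp_all add: cardioidal_starter_def starter_def)
  let ?H = "\<lambda>x. doubling_pair n x \<in> S"
  let ?I = "{x \<in> nonzero_residues n. ?H x}"
  let ?neg = "\<lambda>x. (- x) mod int n"
  have nz: "\<not> int n dvd x" if "?H x" for x
    using that part \<open>n > 0\<close> mod_in_nonzero_residues unfolding partition_on_def by blast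
  have pairE: "\<exists>k. \<not> int n dvd k \<and> P = doubling_pair n k" if "P \<in> S" for P
  proof -
    obtain k where "k \<in> nonzero_residues n" "P = {k, (2 * k) mod int n}"
      using S \<open>P \<in> S\<close> unfolding cardioidal_starter_def by blast
    moreover from this have "k mod int n = k" "\<not> int n dvd k"
      using nonzero_residues_iff \<open>n > 0\<close> by blast+
    ultimately show ?thesis
      by (intro exI [of _ k]) simp
  qed
  have resp: "?H x = ?H y" if "[x = y] (mod int n)" for x y
    using cong_scalar_left [OF that, of 2] that unfolding cong_def by metis
  \<comment> \<open>Both pairs would contain the residue of \<open>2 * x\<close> and hence
    coincide.\<close>
  have dbl: "\<not> ?H (2 * x)" if "?H x" for x
  proof
    assume "?H (2 * x)"
    moreover have "(2 * x) mod int n \<in> doubling_pair n x \<inter> doubling_pair n (2 * x)"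
      by simp
    moreover have "disjoint S"
      using part by (simp add: partition_on_def)
    ultimately have "doubling_pair n x = doubling_pair n (2 * x)"
      using \<open>?H x\<close> by (metis disjointD empty_iff)
    then show False
      using doubling_pair_eq_iff [OF \<open>odd n\<close> n3 nz] doubling_not_cong nz that by blast
  qed
  \<comment> \<open>Modulo \<open>n\<close>, \<open>x\<close> is a difference of a pair {k, 2k}, and
    these differences are k and -k.\<close>
  have cover: "?H x \<or> ?H (- x)" if "\<not> int n dvd x" for x
  proof -
    have "x mod int n \<in> nonzero_residues n"
      using that mod_in_nonzero_residues \<open>n > 0\<close> by blast
    then obtain s t where st: "{s, t} \<in> S" "[x = s - t] (mod int n)"
      unfolding diffs [symmetric] cong_def by blast
    then obtain k where k: "{s, t} = doubling_pair n k"
      using pairE by blast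
    then have "[s = k] (mod int n) \<and> [t = 2 * k] (mod int n) \<or>
               [t = k] (mod int n) \<and> [s = 2 * k] (mod int n)"
      by (auto simp: doubleton_eq_iff cong_def)
    then have "[s - t = - k] (mod int n) \<or> [s - t = k] (mod int n)"
      using cong_diff [of s k "int n" t "2 * k"] cong_diff [of s "2 * k" "int n" t k] by auto
    then have "[- x = k] (mod int n) \<or> [x = k] (mod int n)"
      using st(2) cong_trans cong_minus_minus_iff [of "-x" k "int n"] by force
    then show ?thesis
      using resp [of "- x" k] resp [of x k] st(1) k by metis
  qed
  have fin: "finite (nonzero_residues n)"
    by (simp add: nonzero_residues_def)
  then have "finite S"
    using part finite_elements by blast
  \<comment> \<open>Distinct generators give distinct pairs, so \<open>?I\<close> has at most (n -
    1) / 2 elements. Since \<open>?I\<close> and its negatives cover all n - 1 nonzero residues,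
    they cannot overlap.\<close>
  have "inj_on (doubling_pair n) ?I"
    using doubling_pair_eq_iff [OF \<open>odd n\<close> n3] nonzero_residues_iff [OF \<open>n > 0\<close>]
    by (simp add: inj_on_def cong_def) metis
  then have "card ?I \<le> card S"
    by (rule card_inj_on_le) (use \<open>finite S\<close> in blast)+
  then have card_I: "card ?I \<le> (n - 1) div 2"
    using card_S by simp
  have fin_I: "finite ?I"
    using fin by (rule rev_finite_subset) blast
  have "nonzero_residues n \<subseteq> ?I \<union> ?neg ` ?I"
  proof
    fix x assume x: "x \<in> nonzero_residues n"
    then have x': "x mod int n = x" "\<not> int n dvd x"
      using nonzero_residues_iff \<open>n > 0\<close> by auto
    show "x \<in> ?I \<union> ?neg ` ?I"
    proof (cases "?H x")
      case False
      then have "?H (?neg x)"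
        using x' cover [of x] resp [of "?neg x" "- x"] by simp
      moreover have "?neg x \<in> nonzero_residues n"
        using x'(2) mod_in_nonzero_residues [OF \<open>n > 0\<close>, of "- x"] by simp
      ultimately have "?neg x \<in> ?I"
        by blast
      moreover have "?neg (?neg x) = x"
        using x' by (simp add: mod_minus_eq)
      ultimately have "x \<in> ?neg ` ?I"
        by (intro image_eqI [of x ?neg "?neg x"]) simp_all
      then show ?thesis by blast
    qed (use x in simp)
  qed
  then have "n - 1 \<le> card (?I \<union> ?neg ` ?I)"
    unfolding card_nonzero_residues [of n, symmetric]
    by (rule card_mono [rotated]) (intro finite_UnI finite_imageI fin_I)
  moreover have "card (?I \<union> ?neg ` ?I) + card (?I \<inter> ?neg ` ?I) = card ?I + card (?neg ` ?I)"
    by (rule card_Un_Int [symmetric]) (intro finite_imageI fin_I)+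
  moreover have "card (?neg ` ?I) \<le> card ?I"
    by (rule card_image_le [OF fin_I])
  ultimately have "card (?I \<inter> ?neg ` ?I) = 0"
    using card_I by linarith
  then have int_empty: "?I \<inter> ?neg ` ?I = {}"
    using fin_I by (intro iffD1 [OF card_0_eq]) (blast intro: finite_Int)+
  have disj: "\<not> ?H (- x)" if x: "?H x" for x
  proof
    assume "?H (- x)"
    then have "?H (?neg x)" "?H (x mod int n)"
      using x resp [of "?neg x" "- x"] resp [of "x mod int n" x] by simp_all
    moreover have "?neg x \<in> nonzero_residues n" "x mod int n \<in> nonzero_residues n"
      using nz [OF x] mod_in_nonzero_residues [OF \<open>n > 0\<close>] by simp_all
    ultimately have "?neg x \<in> ?I" "x mod int n \<in> ?I"
      by blast+
    moreover have "?neg (x mod int n) = ?neg x"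
      by (simp add: mod_minus_eq)
    ultimately have "?neg x \<in> ?I \<inter> ?neg ` ?I"
      by (intro IntI image_eqI [of "?neg x" ?neg "x mod int n"]) simp_all
    with int_empty show False by blast
  qed
  show ?thesis
    unfolding half_system_def
  proof (intro conjI allI impI)
    fix x assume "?H x"
    \<comment> \<open>\<open>2 * x\<close> is nonzero as \<open>n\<close> is odd, and it is not a
      generator by \<open>dbl\<close>; \<open>cover\<close> then leaves its negative.\<close>
    then show "?H (- 2 * x)"
      using dbl cover nz odd_dvd_double_iff \<open>odd n\<close> by (metis mult_minus_left)
  qed (use resp disj cover in blast)+
qed

section \<open>From half systems to strong cardioidal starters\<close>

text \<open>The starter consists of the pairs {x, 2x} with \<open>x\<close> in \<open>H\<close>.
  Doubling exchanges \<open>H\<close> with its complement in the nonzero residues, so these pairs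
  form a partition. Their differences are \<open>x\<close> and \<open>- x\<close>, and their sums 3x
  are nonzero and distinct because 3 is invertible.\<close>

lemma half_system_imp_strong_cardioidal:
  assumes H: "half_system n H" and "odd n" and n3: "\<not> 3 dvd n"
  shows "\<exists>S. strong_starter n S \<and> cardioidal_starter n S"
proof -
  have "n > 0" using \<open>odd n\<close> by (simp add: odd_pos)
  have resp: "H x = H y" if "[x = y] (mod int n)" for x y
    using H that by (simp add: half_system_def)
  have neg: "H (- x) = (\<not> H x)" if "\<not> int n dvd x" for x
    using H that by (simp add: half_system_def)
  have dbl: "H (2 * x) = (\<not> H x)" if "\<not> int n dvd x" for x
  proof -
    have "H x \<Longrightarrow> H (- 2 * x)" "H (- x) \<Longrightarrow> H (- 2 * (- x))"
      using H unfolding half_system_def by blast+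
    then show ?thesis
      using neg [of x] neg [of "2 * x"] that odd_dvd_double_iff [OF \<open>odd n\<close>] by auto
  qed
  define X where "X = nonzero_residues n"
  define I where "I = {x \<in> X. H x}"
  define S where "S = doubling_pair n ` I"
  have X_iff: "x \<in> X \<longleftrightarrow> x mod int n = x \<and> \<not> int n dvd x" for x
    using nonzero_residues_iff \<open>n > 0\<close> by (simp add: X_def)
  have fin: "finite X"
    by (simp add: nonzero_residues_def X_def)
  have mod_X: "x mod int n \<in> X \<longleftrightarrow> \<not> int n dvd x" for x
    using mod_in_nonzero_residues \<open>n > 0\<close> by (simp add: X_def)
  have mod_H: "H (x mod int n) = H x" for x
    by (rule resp) simp
  have inj: "inj_on (doubling_pair n) I"
    using doubling_pair_eq_iff [OF \<open>odd n\<close> n3] X_iff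
    by (simp add: inj_on_def cong_def I_def) metis
  \<comment> \<open>Negation exchanges \<open>I\<close> with its complement, so \<open>I\<close>
    contains exactly half of \<open>X\<close>.\<close>
  have "bij_betw (\<lambda>x. (- x) mod int n) I (X - I)"
  proof (rule bij_betw_byWitness [where f' = "\<lambda>x. (- x) mod int n"])
  qed (auto simp: I_def X_iff mod_X mod_H neg mod_minus_eq dvd_mod_iff)
  then have "card I = card (X - I)"
    by (rule bij_betw_same_card)
  moreover have "card (X - I) = card X - card I"
    using fin by (intro card_Diff_subset) (auto simp: I_def intro: finite_subset)
  moreover have "card I \<le> card X"
    using fin by (intro card_mono) (auto simp: I_def)
  ultimately have card_I: "card I = (n - 1) div 2"
    using card_nonzero_residues [of n] by (simp add: X_def)
  have part: "partition_on X S"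
  proof (rule partition_onI)
    show "\<Union> S = X"
    proof
      show "\<Union> S \<subseteq> X"
        by (auto simp: S_def I_def X_iff mod_X odd_dvd_double_iff [OF \<open>odd n\<close>] dvd_mod_iff)
      show "X \<subseteq> \<Union> S"
      proof
        fix x assume x: "x \<in> X"
        show "x \<in> \<Union> S"
        proof (cases "H x")
          case True
          with x show ?thesis by (auto simp: S_def I_def X_iff)
        next
          case False
          \<comment> \<open>Modulo the odd number \<open>n\<close> every \<open>x\<close> can be
            halved. As \<open>x\<close> is outside \<open>H\<close>, its half lies in
            \<open>H\<close>, and \<open>x\<close> is the second entry of that pair.\<close>
          obtain k where k: "[2 * k = x] (mod int n)"
            using cong_solve_coprime_int [of 2 "int n"] \<open>odd n\<close> cong_scalar_right [of _ 1 "int n" x]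
            by (metis coprime_left_2_iff_odd even_of_nat mult.assoc mult_1)
          then have "\<not> int n dvd k"
            using x X_iff cong_dvd_iff odd_dvd_double_iff [OF \<open>odd n\<close>] by (metis cong_iff_dvd_diff dvd_diff_right_iff)
          then have "k mod int n \<in> I"
            using dbl [of k] False resp [OF k] by (simp add: I_def mod_X mod_H)
          moreover have "x \<in> doubling_pair n (k mod int n)"
            using k x by (simp add: cong_def X_iff mod_mult_right_eq)
          ultimately show ?thesis
            unfolding S_def by blast
        qed
      qed
    qed
    show "disjnt p q" if "p \<in> S" "q \<in> S" "p \<noteq> q" for p q
    proof -
      obtain x y where xy: "x \<in> I" "y \<in> I" "p = doubling_pair n x" "q = doubling_pair n y"
        using \<open>p \<in> S\<close> \<open>q \<in> S\<close> unfolding S_def by blast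
      have "x \<noteq> y" using xy that by blast
      have nx: "x mod int n \<noteq> y mod int n"
        using xy \<open>x \<noteq> y\<close> by (simp add: I_def X_iff)
      have "\<not> [2 * x = 2 * y] (mod int n)"
        using nx \<open>odd n\<close> by (simp add: cong_mult_lcancel coprime_commute cong_def [symmetric])
      \<comment> \<open>\<open>H\<close> holds at \<open>x\<close> and \<open>y\<close> but fails at
        their doubles.\<close>
      moreover have "\<not> [x = 2 * y] (mod int n)" "\<not> [2 * x = y] (mod int n)"
        using xy dbl [of x] dbl [of y] resp by (auto simp: I_def X_iff)
      ultimately show ?thesis
        using nx xy by (auto simp: disjnt_def cong_def)
    qed
  qed (auto simp: S_def)
  have starter: "starter n S"
    unfolding starter_def
  proof (intro conjI ballI)
    show "partition_on (nonzero_residues n) S"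
      using part by (simp add: X_def)
    show "card S = (n - 1) div 2"
      using card_image [OF inj] card_I by (simp add: S_def)
    show "card P = 2" if "P \<in> S" for P
    proof -
      obtain x where "P = doubling_pair n x" "x \<in> I"
        using \<open>P \<in> S\<close> unfolding S_def by blast
      moreover from this have "\<not> int n dvd x"
        by (simp add: I_def X_iff)
      ultimately show ?thesis
        using doubling_not_cong [of n x] by (simp add: cong_def)
    qed
    show "{(s - t) mod int n |s t. {s, t} \<in> S} = nonzero_residues n"
      unfolding X_def [symmetric]
    proof (intro equalityI subsetI)
      fix d assume "d \<in> {(s - t) mod int n |s t. {s, t} \<in> S}"
      then obtain s t x where d: "d = (s - t) mod int n" "x \<in> I" "{s, t} = doubling_pair n x"
        unfolding S_def by blast
      then have "d = (x - 2 * x) mod int n \<or> d = (2 * x - x) mod int n"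
        by (auto simp: doubleton_eq_iff mod_diff_eq simp del: mod_diff_left_eq)
      then have "d = (- x) mod int n \<or> d = x mod int n"
        by simp
      with d(2) show "d \<in> X"
        by (auto simp: I_def mod_X X_iff dvd_mod_iff)
    next
      fix d assume d: "d \<in> X"
      show "d \<in> {(s - t) mod int n |s t. {s, t} \<in> S}"
      proof (cases "H d")
        case True
        then have "{(2 * d) mod int n, d mod int n} \<in> S"
          using d by (auto simp: S_def I_def insert_commute)
        moreover have "d = ((2 * d) mod int n - d mod int n) mod int n"
          using d mod_diff_eq [of "2 * d" "int n" d] by (simp add: X_iff del: mod_diff_left_eq mod_diff_right_eq)
        ultimately show ?thesis by blast
      next
        case False
        \<comment> \<open>Here \<open>d\<close> arises as e - 2e, the difference of the pair of e
          taken in the opposite order.\<close>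
        let ?e = "(- d) mod int n"
        have "?e \<in> I"
          using False d neg [of d] by (simp add: I_def mod_X mod_H X_iff dvd_mod_iff)
        then have "doubling_pair n ?e \<in> S"
          unfolding S_def by (rule imageI)
        moreover have "(?e mod int n - (2 * ?e) mod int n) mod int n = (?e - 2 * ?e) mod int n"
          by (rule mod_diff_eq)
        moreover have "(?e - 2 * ?e) mod int n = d"
          using d by (simp add: mod_minus_eq X_iff)
        ultimately show ?thesis by (metis (mono_tags, lifting) mem_Collect_eq)
      qed
    qed
  qed (fact \<open>odd n\<close>)
  have cardioidal: "\<exists>i\<in>nonzero_residues n. P = {i, (2 * i) mod int n}" if "P \<in> S" for P
    using that by (auto simp: S_def I_def X_iff simp flip: X_def)
  have sum_nonzero: "(\<Sum>x\<in>P. x) mod int n \<noteq> 0" if "P \<in> S" for P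
  proof -
    obtain x where "P = doubling_pair n x" "x \<in> I"
      using \<open>P \<in> S\<close> unfolding S_def by blast
    moreover from this have "\<not> int n dvd x"
      by (simp add: I_def X_iff)
    ultimately show ?thesis
      using sum_doubling_pair [of n x] dvd_three_mult_iff [OF n3, of x] by (simp only: dvd_eq_mod_eq_0 not_False_eq_True)
  qed
  have sum_inj: "inj_on (\<lambda>P. (\<Sum>x\<in>P. x) mod int n) S"
    unfolding S_def
  proof (intro inj_onI; elim imageE; hypsubst)
    fix x y assume xy: "x \<in> I" "y \<in> I"
      and "(\<Sum>x\<in>doubling_pair n x. x) mod int n = (\<Sum>x\<in>doubling_pair n y. x) mod int n"
    then have "[3 * x = 3 * y] (mod int n)"
      using sum_doubling_pair [of n x] sum_doubling_pair [of n y]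
      unfolding cong_def I_def by (simp only: X_iff mem_Collect_eq not_False_eq_True)
    then have "int n dvd 3 * (x - y)"
      by (simp add: cong_iff_dvd_diff algebra_simps)
    then have "x mod int n = y mod int n"
      using dvd_three_mult_iff [OF n3] by (simp only: mod_eq_dvd_iff)
    with xy show "doubling_pair n x = doubling_pair n y"
      by (simp add: I_def X_iff)
  qed
  have "strong_starter n S"
    unfolding strong_starter_def by (intro conjI ballI starter sum_nonzero sum_inj)
  moreover have "cardioidal_starter n S"
    unfolding cardioidal_starter_def by (intro conjI ballI starter cardioidal)
  ultimately show ?thesis
    by blast
qed

section \<open>Reduction to conditions on the prime divisors of n\<close>

theorem theorem6:
  fixes n :: nat
  assumes "n \<ge> 3" and "odd n"
  shows "(\<exists>S. strong_starter n S \<and> cardioidal_starter n S) \<longleftrightarrow> n \<in> prime_products (C2 - {3})"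
proof -
  have "n > 0" "n > 1"
    using \<open>n \<ge> 3\<close> by simp_all
  have starter_iff: "(\<exists>S. strong_starter n S \<and> cardioidal_starter n S) \<longleftrightarrow>
      \<not> 3 dvd n \<and> (\<exists>H. half_system n H)"
    using strong_cardioidal_imp_not_3_dvd [OF _ _ \<open>n > 0\<close>]
      strong_cardioidal_imp_half_system [OF _ _ \<open>n > 0\<close>]
      half_system_imp_strong_cardioidal [OF _ \<open>odd n\<close>] by blast
  have half_iff: "(\<exists>H. half_system n H) \<longleftrightarrow>
      (\<forall>p. prime p \<and> p dvd n \<longrightarrow> (\<forall>j. \<not> int p dvd (-2) ^ j + 1))"
    using half_system_imp_not_dvd [OF _ _ _ \<open>n > 0\<close>] half_system_exists [OF \<open>odd n\<close>] by blast
  have C2_iff: "(\<forall>j. \<not> int p dvd (-2) ^ j + 1) \<longleftrightarrow> p \<in> C2" if "prime p" "p dvd n" for p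
  proof -
    have "odd p"
      using \<open>p dvd n\<close> \<open>odd n\<close> dvd_trans by blast
    then show ?thesis
      using mem_C2_iff [OF \<open>prime p\<close>] by blast
  qed
  have "n \<in> prime_products (C2 - {3}) \<longleftrightarrow> (\<forall>p. prime p \<and> p dvd n \<longrightarrow> p \<in> C2 - {3})"
    by (rule mem_prime_products_iff [OF \<open>n > 1\<close>]) (simp add: C2_def)
  also have "\<dots> \<longleftrightarrow> \<not> 3 dvd n \<and> (\<forall>p. prime p \<and> p dvd n \<longrightarrow> p \<in> C2)"
  proof -
    \<comment> \<open>Primality of 3 turns divisibility by 3 into a condition on prime divisors. It
      needs separate mention because 2 has order 2 modulo 3, so that 3 lies in
      \<open>C2\<close>.\<close>
    have "prime (3::nat)" by simp
    then show ?thesis by blast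
  qed
  finally show ?thesis
    unfolding starter_iff half_iff using C2_iff by blast
qed

end
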